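(* $R(4,8)\ge 58$. Equivalently, there exists a two-coloring of the edges of the complete graph $K_{57}$ such that there is no complete subgraph on 4 vertices all of whose edges have the first color, and no complete subgraph on 8 vertices all of whose edges have the second color.
   Context: For positive integers $s,t$, the classical Ramsey number $R(s,t)$ is the smallest integer $n$ such that every two-coloring of the edges of the complete graph $K_n$ contains a copy of $K_s$ all of whose edges have the first color or a copy of $K_t$ all of whose edges have the second color. *)

theory Defs
  imports "HOL-Library.Ramsey"
begin

(* partn_lst {..<n} [s, t] 2 says that every map from the 2-element subsets of {..<n} (the edges of
   K_n) to the colours {0, 1} has an s-clique of colour 0 or a t-clique of colour 1. *)
definition ramsey_number :: "nat \<Rightarrow> nat \<Rightarrow> nat" where
  "ramsey_number s t = (LEAST n. partn_lst {..<n} [s, t] 2)"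

(* The minimum is attained, so LEAST is not applied to an empty predicate. *)
lemma partn_lst_ramsey_number: "partn_lst {..<ramsey_number s t} [s, t] 2"
  unfolding ramsey_number_def using ramsey_full[of "[s, t]" 2] by (rule LeastI_ex)

end

theory Submission
  imports Defs
begin

text \<open>
  The colouring is an explicit 57-vertex graph, found by tabu search: a graph invariant under
  \<open>i \<mapsto> i + 1\<close> on three copies of the integers modulo 19 was optimised first, and the symmetry
  was then given up to repair its few remaining monochromatic cliques.  A backtracking search
  that abandons a branch once too few candidate vertices are left shows, in about ten thousand
  nodes, that the graph has no 4-clique and its complement no 8-clique.
\<close>

section \<open>Pruned clique search on triangular adjacency lists\<close>

fun meet :: "bool list \<Rightarrow> bool list \<Rightarrow> bool list" where
  "meet (a # as) (b # bs) = (a \<and> b) # meet as bs"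
| "meet _ _ = []"

fun at_least :: "nat \<Rightarrow> bool list \<Rightarrow> bool" where
  "at_least 0 bs = True"
| "at_least (Suc k) [] = False"
| "at_least (Suc k) (True # bs) = at_least k bs"
| "at_least (Suc k) (False # bs) = at_least (Suc k) bs"

text \<open>
  A graph on \<open>{..<n}\<close> is stored as the strict upper triangle of its adjacency matrix, so that the
  tail of the list of rows represents the graph on the vertices after the first one.  The list
  \<open>cs\<close> marks the candidate vertices.  The tests are written with \<open>if\<close> because the simplifier
  would evaluate both sides of an implication.
\<close>

fun clique_free :: "nat \<Rightarrow> bool list list \<Rightarrow> bool list \<Rightarrow> bool" where
  "clique_free 0 rs cs = False"
| "clique_free (Suc k) (r # rs) (True # cs) =
     ((let ds = meet r cs in if at_least k ds then clique_free k rs ds else True) \<and>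
      (if at_least (Suc k) cs then clique_free (Suc k) rs cs else True))"
| "clique_free (Suc k) (r # rs) (False # cs) = clique_free (Suc k) rs cs"
| "clique_free (Suc k) _ _ = True"

text \<open>The last row is empty, so the number of rows equals the number of vertices.\<close>

fun triangular :: "bool list list \<Rightarrow> bool" where
  "triangular [] = True"
| "triangular (r # rs) = (length r = length rs \<and> triangular rs)"

text \<open>Row \<open>i\<close> starts with the entry for vertex \<open>Suc i\<close>, hence the
  offset \<open>j - Suc i\<close>.\<close>

definition is_clique :: "bool list list \<Rightarrow> nat set \<Rightarrow> bool" where
  "is_clique rs S \<longleftrightarrow> (\<forall>i\<in>S. \<forall>j\<in>S. i < j \<longrightarrow> rs ! i ! (j - Suc i))"

section \<open>Soundness of the search\<close>

lemma length_meet [simp]: "length (meet as bs) = min (length as) (length bs)"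
  by (induction as bs rule: meet.induct) auto

lemma nth_meet: "i < length as \<Longrightarrow> i < length bs \<Longrightarrow> meet as bs ! i \<longleftrightarrow> as ! i \<and> bs ! i"
proof (induction as bs arbitrary: i rule: meet.induct)
  case (1 a as b bs)
  then show ?case by (cases i) auto
qed auto

lemma card_Suc_vimage:
  assumes "finite S"
  shows "card S = (if 0 \<in> S then 1 else 0) + card (Suc -` S)"
proof -
  have "S = (S \<inter> {0}) \<union> Suc ` (Suc -` S)"
    by (auto simp: image_iff) (metis not0_implies_Suc)
  moreover have "card ((S \<inter> {0}) \<union> Suc ` (Suc -` S)) = card (S \<inter> {0}) + card (Suc ` (Suc -` S))"
    using assms by (intro card_Un_disjoint) (auto intro: finite_vimageI)
  ultimately have "card S = card (S \<inter> {0}) + card (Suc -` S)"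
    by (metis card_image inj_Suc inj_on_subset subset_UNIV)
  then show ?thesis by auto
qed

text \<open>Justifies pruning: a failed test means that every set of candidates has fewer than
  \<open>k\<close> elements.\<close>

lemma at_least_if_le_card:
  assumes "S \<subseteq> {i. i < length bs \<and> bs ! i}" and "k \<le> card S"
  shows "at_least k bs"
  using assms
proof (induction k bs arbitrary: S rule: at_least.induct)
  case (3 k bs)
  have "finite S"
    using "3.prems"(1) by (rule finite_subset) simp
  then have "k \<le> card (Suc -` S)"
    using "3.prems"(2) card_Suc_vimage[of S] by (simp split: if_splits)
  moreover have "Suc -` S \<subseteq> {i. i < length bs \<and> bs ! i}"
    using "3.prems"(1) by auto
  ultimately show ?case
    using "3.IH" by simp
next
  case (4 k bs)
  have "finite S"
    using "4.prems"(1) by (rule finite_subset) simp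
  moreover have "0 \<notin> S"
    using "4.prems"(1) by auto
  ultimately have "Suc k \<le> card (Suc -` S)"
    using "4.prems"(2) card_Suc_vimage[of S] by simp
  moreover have "Suc -` S \<subseteq> {i. i < length bs \<and> bs ! i}"
    using "4.prems"(1) by auto
  ultimately show ?case
    using "4.IH" by simp
qed auto

text \<open>Shifting both endpoints by one leaves the offset \<open>j - Suc i\<close> unchanged and
  moves from row \<open>Suc i\<close> of \<open>r # rs\<close> to row \<open>i\<close> of
  \<open>rs\<close>.\<close>

lemma is_clique_Suc_vimage: "is_clique (r # rs) S \<Longrightarrow> is_clique rs (Suc -` S)"
  unfolding is_clique_def by fastforce

text \<open>The induction follows the branches of the search: a clique containing vertex 0 has its
  other vertices among the candidates adjacent to 0, and any other clique lives on the tail.\<close>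

lemma clique_free_sound:
  assumes "clique_free k rs cs" and "triangular rs" and "length cs = length rs"
    and "S \<subseteq> {i. i < length cs \<and> cs ! i}" and "is_clique rs S"
  shows "card S \<noteq> k"
  using assms
proof (induction k rs cs arbitrary: S rule: clique_free.induct)
  case (2 k r rs cs)
  let ?S = "Suc -` S" and ?ds = "meet r cs"
  have "finite S"
    using "2.prems"(4) by (rule finite_subset) simp
  then have card: "card S = (if 0 \<in> S then 1 else 0) + card ?S"
    by (rule card_Suc_vimage)
  have sub: "?S \<subseteq> {i. i < length cs \<and> cs ! i}"
    using "2.prems"(4) by auto
  have clique: "is_clique rs ?S"
    using "2.prems"(5) by (rule is_clique_Suc_vimage)
  have len: "length r = length rs" "triangular rs" "length cs = length rs"
    using "2.prems"(2,3) by auto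
  show ?case
  proof (cases "0 \<in> S")
    case True
    \<comment> \<open>Entry \<open>i\<close> of the first row is the edge between 0 and
      \<open>Suc i\<close>.\<close>
    then have "r ! i" if "i \<in> ?S" for i
      using that "2.prems"(5) unfolding is_clique_def by fastforce
    then have "?S \<subseteq> {i. i < length ?ds \<and> ?ds ! i}"
      using sub len by (auto simp: nth_meet)
    \<comment> \<open>If the branch was searched, the induction hypothesis applies; if it was
      pruned, \<open>?S\<close> has fewer than \<open>k\<close> elements.\<close>
    then have "card ?S \<noteq> k"
      using "2.IH"(1)[OF refl _ _ len(2) _ _ clique] at_least_if_le_card[of ?S ?ds k]
        "2.prems"(1) len by (auto simp: Let_def split: if_splits)
    then show ?thesis
      using card True by simp
  next
    case False
    have "card ?S \<noteq> Suc k"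
      using "2.IH"(2)[OF _ _ len(2,3) sub clique] at_least_if_le_card[OF sub, of "Suc k"]
        "2.prems"(1) by (auto split: if_splits)
    then show ?thesis
      using card False by simp
  qed
next
  case (3 k r rs cs)
  have "finite S"
    using "3.prems"(4) by (rule finite_subset) simp
  moreover have "0 \<notin> S"
    using "3.prems"(4) by auto
  ultimately have "card S = card (Suc -` S)"
    by (simp add: card_Suc_vimage)
  moreover have "Suc -` S \<subseteq> {i. i < length cs \<and> cs ! i}"
    using "3.prems"(4) by auto
  ultimately show ?case
    using "3.IH"[OF _ _ _ _ is_clique_Suc_vimage] "3.prems" by simp
qed auto

text \<open>It suffices that \<open>rs\<close> contains all edges of colour \<open>c\<close>, since
  a clique of that colour is then a clique of \<open>rs\<close>. This serves the graph with colour 0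
  and its complement with colour 1.\<close>

lemma not_monochromatic_if_clique_free:
  assumes "clique_free k rs (map (\<lambda>_. True) rs)" and "triangular rs"
    and f: "\<And>i j. i < j \<Longrightarrow> j < length rs \<Longrightarrow> f {i, j} = c \<Longrightarrow> rs ! i ! (j - Suc i)"
  shows "\<not> monochromatic {..<length rs} k 2 f c"
proof
  assume "monochromatic {..<length rs} k 2 f c"
  then obtain S where S: "S \<subseteq> {..<length rs}" "card S = k" and mono: "f ` nsets S 2 \<subseteq> {c}"
    by (auto simp: monochromatic_def nsets_def)
  have "is_clique rs S"
    unfolding is_clique_def
  proof (intro ballI impI)
    fix i j assume "i \<in> S" "j \<in> S" "i < j"
    then have "{i, j} \<in> nsets S 2"
      by simp
    then have "f {i, j} = c"
      using mono by blast
    then show "rs ! i ! (j - Suc i)"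
      using f \<open>i < j\<close> \<open>j \<in> S\<close> S(1) by auto
  qed
  moreover have "S \<subseteq> {i. i < length (map (\<lambda>_. True) rs) \<and> map (\<lambda>_. True) rs ! i}"
    using S(1) by auto
  ultimately have "card S \<noteq> k"
    using assms(1,2) by (intro clique_free_sound) auto
  then show False
    using S(2) by simp
qed

lemma triangular_map: "(\<And>r. length (h r) = length r) \<Longrightarrow> triangular (map h rs) = triangular rs"
  by (induction rs) auto

text \<open>Supplies the index bound under which an entry of \<open>map (map Not) rs\<close> is the
  negation of the entry of \<open>rs\<close>.\<close>

lemma length_nth_triangular: "triangular rs \<Longrightarrow> i < length rs \<Longrightarrow> length (rs ! i) = length rs - Suc i"
proof (induction rs arbitrary: i)
  case (Cons r rs)
  then show ?case by (cases i) auto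
qed auto

section \<open>The graph on 57 vertices and the evaluation of the search\<close>

abbreviation (input) "T \<equiv> True"
abbreviation (input) "F \<equiv> False"

definition ramsey_graph :: "bool list list" where
  "ramsey_graph = [
   [T,F,T,F,F,F,T,F,F,F,F,F,T,F,F,T,F,T,F,T,T,T,T,T,F,F,F,F,F,T,F,F,F,T,F,F,F,T,F,T,F,F,F,T,F,F,T,T
    ,F,F,T,T,F,T,F,F],
   [T,F,T,F,F,F,F,T,F,F,T,F,T,F,F,T,F,F,F,T,T,T,T,T,F,F,F,F,F,F,F,F,F,F,F,F,T,T,F,T,F,T,F,T,F,F,F,F
    ,F,F,T,T,F,T,F],
   [T,F,F,F,F,F,F,T,F,F,T,F,F,F,F,T,F,F,F,T,T,T,T,T,F,F,F,F,T,F,F,F,F,T,F,F,T,T,F,T,F,F,F,T,F,T,T,F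
    ,T,F,T,F,F,T],
   [T,F,T,F,F,T,F,F,F,F,F,F,F,F,F,F,F,T,F,T,T,T,F,T,F,F,F,F,T,F,F,F,F,T,F,F,T,T,F,T,F,F,F,T,F,T,T,F
    ,T,F,T,F,F],
   [T,F,T,F,F,F,F,F,F,F,F,F,F,F,T,F,F,F,F,T,F,T,T,T,F,T,F,F,T,F,F,F,F,F,T,F,T,F,F,T,F,F,F,T,F,T,T,F
    ,T,F,F,T],
   [T,F,T,F,F,F,F,T,F,F,T,F,F,F,T,F,F,F,F,T,T,T,T,T,F,F,F,F,T,F,F,F,T,F,T,T,T,F,F,T,F,F,F,T,F,T,T,F
    ,F,F,T],
   [T,F,T,F,F,F,F,T,F,F,T,T,F,F,F,F,F,F,F,T,T,T,T,T,F,F,F,F,F,F,F,T,T,F,F,T,F,T,F,T,F,T,F,T,F,T,T,F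
    ,F,F],
   [T,F,T,F,F,T,F,T,F,F,F,F,F,T,F,F,F,F,F,T,T,T,T,T,F,F,F,F,T,F,F,T,F,F,F,T,T,T,F,T,F,F,F,F,F,T,F,F
    ,F],
   [T,F,F,F,F,T,F,F,F,F,F,F,F,T,F,F,F,T,F,T,T,T,F,T,F,F,F,F,T,T,T,T,F,F,F,F,T,T,F,T,F,F,F,T,T,T,T,F
    ],
   [F,F,T,F,F,F,F,F,F,T,F,F,F,F,T,F,F,F,F,T,F,F,F,T,F,F,F,F,T,F,F,T,T,F,T,F,T,T,F,F,F,T,F,T,F,T,T],
   [F,F,T,F,F,F,F,F,F,T,F,F,F,F,T,F,F,F,F,T,F,F,F,T,F,F,F,T,F,F,T,T,T,F,T,F,T,T,F,T,F,T,F,F,F,T],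
   [T,F,T,F,F,F,F,F,F,T,F,F,F,F,T,F,F,F,F,T,F,T,T,T,F,T,T,T,T,F,F,T,T,F,T,F,T,T,T,T,F,F,F,T,F],
   [T,F,T,F,F,T,F,F,F,T,F,F,F,F,T,F,F,F,F,T,T,T,T,T,F,F,T,T,F,F,F,T,T,F,F,F,F,T,F,T,F,F,F,T],
   [T,F,T,F,F,F,F,F,F,F,F,F,F,F,F,F,F,F,F,T,T,T,T,T,T,F,T,F,F,F,F,F,T,F,F,F,T,T,F,T,F,T,F],
   [T,F,T,F,T,F,F,F,F,T,F,F,F,F,T,F,F,F,F,T,T,T,T,F,T,F,T,F,F,F,F,T,T,F,F,F,T,F,F,T,F,F],
   [T,F,F,F,T,F,F,F,F,T,F,F,F,F,T,F,F,T,F,T,T,T,F,F,T,T,T,T,F,F,F,T,T,F,T,F,T,T,F,T,F],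
   [F,F,F,F,T,F,F,F,F,T,F,F,F,F,T,F,F,F,F,T,F,F,T,F,F,F,T,T,T,T,F,T,T,T,F,F,T,T,F,T],
   [T,F,F,F,T,F,F,F,F,T,F,F,F,F,T,F,F,F,F,T,F,F,T,F,T,F,T,T,F,F,F,F,T,F,F,T,T,T,F],
   [T,F,T,T,T,F,T,F,F,F,T,F,F,F,T,F,F,F,F,T,F,F,F,F,T,F,T,T,T,F,F,F,T,T,F,F,F,T],
   [F,T,T,T,F,F,T,T,T,F,T,F,F,F,T,T,T,T,F,F,F,T,F,F,F,F,T,F,F,F,F,T,T,F,F,F,T],
   [T,T,T,T,F,T,T,T,T,F,F,F,F,F,T,F,T,T,F,F,F,T,F,F,F,F,T,F,F,F,F,T,F,F,F,F],
   [F,F,F,F,F,F,F,T,F,F,T,T,T,F,F,T,F,T,F,T,T,T,F,T,F,F,F,T,F,F,F,T,F,F,F],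
   [F,F,F,F,F,T,T,T,T,F,F,F,F,F,F,F,F,T,T,T,T,T,F,F,F,F,F,T,F,F,F,T,F,F],
   [F,F,T,F,F,T,F,T,T,T,F,F,T,T,F,F,F,T,T,T,T,T,F,F,F,F,F,F,F,F,F,F,F],
   [F,F,F,F,F,T,F,T,F,T,F,F,T,F,F,F,F,T,T,T,T,T,F,F,F,F,T,F,F,F,F,T],
   [T,F,T,F,F,T,T,F,F,T,T,T,T,F,F,T,F,T,T,T,F,T,F,F,F,F,T,F,F,F,F],
   [F,F,F,F,F,T,F,T,F,F,F,F,T,F,F,F,F,T,F,T,T,T,F,T,F,F,T,F,F,F],
   [F,F,F,T,F,T,F,T,F,F,F,F,T,F,F,F,F,T,T,T,T,T,F,F,F,F,T,F,F],
   [F,F,T,T,T,T,F,T,F,F,F,F,F,F,T,F,F,T,T,T,T,T,F,F,F,F,F,F],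
   [F,T,T,F,F,T,T,F,F,F,F,T,F,F,F,F,F,T,T,T,T,T,F,F,F,F,T],
   [F,T,F,F,T,F,F,T,F,F,F,T,F,F,F,T,F,T,T,T,F,T,F,F,F,F],
   [F,T,T,T,F,T,F,T,F,F,F,F,T,F,F,F,F,T,F,F,F,T,F,F,F],
   [T,F,T,F,F,F,F,T,F,F,F,F,T,F,F,F,F,T,F,F,F,T,F,F],
   [F,F,F,F,T,F,F,T,F,F,F,F,T,F,F,F,F,T,F,T,T,T,F],
   [F,F,F,F,F,F,F,T,F,F,F,F,T,F,F,F,F,T,T,T,T,T],
   [F,F,T,F,F,F,F,F,F,F,F,F,F,F,F,F,F,T,T,T,T],
   [F,T,T,F,F,F,F,T,F,F,F,F,T,F,F,F,F,T,T,T],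
   [T,F,T,F,F,F,F,T,F,F,F,F,T,F,F,T,F,T,T],
   [T,F,F,F,F,F,F,F,F,F,T,F,F,F,F,T,F,T],
   [F,F,T,F,F,F,F,T,F,F,F,F,F,F,F,T,F],
   [T,F,T,F,F,F,F,T,F,F,F,F,F,F,F,T],
   [T,F,T,F,F,F,F,F,F,F,F,F,T,F,F],
   [T,F,T,F,F,F,T,F,F,F,F,F,T,F],
   [T,F,T,F,F,F,F,T,F,F,T,F,T],
   [T,F,F,F,F,F,F,T,F,F,T,F],
   [F,F,T,F,F,T,F,F,F,F,F],
   [T,F,T,F,F,F,F,F,F,F],
   [T,F,T,F,F,F,F,T,F],
   [T,F,T,F,F,F,F,F],
   [T,F,T,F,F,T,F],
   [T,F,F,F,F,T],
   [F,F,T,F,F],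
   [T,F,T,F],
   [T,F,T],
   [T,F],
   [T],
   []]"

lemma length_ramsey_graph: "length ramsey_graph = 57"
  by (simp add: ramsey_graph_def)

lemma triangular_ramsey_graph: "triangular ramsey_graph"
  by code_simp

lemma ramsey_graph_4_clique_free:
  "clique_free (Suc (Suc (Suc (Suc 0)))) ramsey_graph (map (\<lambda>_. True) ramsey_graph)"
  by code_simp

lemma ramsey_graph_complement_8_clique_free:
  "clique_free (Suc (Suc (Suc (Suc (Suc (Suc (Suc (Suc 0)))))))) (map (map Not) ramsey_graph)
     (map (\<lambda>_. True) ramsey_graph)"
  by code_simp

section \<open>The colouring and the lower bound\<close>

text \<open>\<open>Min\<close> and \<open>Max\<close> order the endpoints of an edge, as the upper
  triangle requires.\<close>

definition ramsey_colouring :: "nat set \<Rightarrow> nat" where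
  "ramsey_colouring e = (if ramsey_graph ! Min e ! (Max e - Suc (Min e)) then 0 else 1)"

lemma ramsey_colouring_pair:
  "i < j \<Longrightarrow> ramsey_colouring {i, j} = (if ramsey_graph ! i ! (j - Suc i) then 0 else 1)"
  by (simp add: ramsey_colouring_def)

lemma ramsey_colouring_no_4_clique: "\<not> monochromatic {..<57} 4 2 ramsey_colouring 0"
  using not_monochromatic_if_clique_free[OF ramsey_graph_4_clique_free triangular_ramsey_graph,
      of ramsey_colouring 0]
  by (simp add: ramsey_colouring_pair length_ramsey_graph eval_nat_numeral split: if_splits)

lemma ramsey_colouring_no_8_clique: "\<not> monochromatic {..<57} 8 2 ramsey_colouring 1"
proof -
  let ?rs = "map (map Not) ramsey_graph"
  have "clique_free 8 ?rs (map (\<lambda>_. True) ?rs)"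
    using ramsey_graph_complement_8_clique_free by (simp add: comp_def eval_nat_numeral)
  moreover have "triangular ?rs"
    by (simp add: triangular_map triangular_ramsey_graph)
  moreover have "?rs ! i ! (j - Suc i)"
    if "i < j" "j < length ?rs" "ramsey_colouring {i, j} = 1" for i j
    using that length_nth_triangular[OF triangular_ramsey_graph, of i]
    by (simp add: ramsey_colouring_pair split: if_splits)
  ultimately have "\<not> monochromatic {..<length ?rs} 8 2 ramsey_colouring 1"
    by (rule not_monochromatic_if_clique_free)
  then show ?thesis
    by (simp add: length_ramsey_graph)
qed

theorem mainTheorem1:
  shows "ramsey_number 4 8 \<ge> 58 \<and>
    (\<exists>f \<in> nsets {..<57::nat} 2 \<rightarrow> {..<2::nat}.
        \<not> monochromatic {..<57} 4 2 f 0 \<and> \<not> monochromatic {..<57} 8 2 f 1)"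
proof
  have range: "ramsey_colouring \<in> nsets {..<57} 2 \<rightarrow> {..<2}"
    by (auto simp: ramsey_colouring_def)
  have "\<not> partn_lst {..<57::nat} [4, 8] 2"
  proof
    assume "partn_lst {..<57::nat} [4, 8] 2"
    then obtain i where "i < 2" "monochromatic {..<57} ([4, 8] ! i) 2 ramsey_colouring i"
      using range by (auto simp: partn_lst_def numeral_2_eq_2)
    then show False
      using ramsey_colouring_no_4_clique ramsey_colouring_no_8_clique by (auto simp: less_2_cases_iff)
  qed
  \<comment> \<open>The partition property passes to larger vertex sets, so a Ramsey number of at
    most 57 would give it for \<open>{..<57}\<close>.\<close>
  then show "58 \<le> ramsey_number 4 8"
    using partn_lst_greater_resource[OF partn_lst_ramsey_number[of 4 8], of 57] by linarith
  show "\<exists>f \<in> nsets {..<57::nat} 2 \<rightarrow> {..<2::nat}.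
      \<not> monochromatic {..<57} 4 2 f 0 \<and> \<not> monochromatic {..<57} 8 2 f 1"
    using range ramsey_colouring_no_4_clique ramsey_colouring_no_8_clique by blast
qed

end
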